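(* Let $\mathcal{B}$ be a uniformly convex Banach space with modulus of uniform convexity $u$. Fix $\varepsilon>0$ and $x\in\mathcal{B}$ with $x\neq0$. Pick some $\eta>0$ such that $\eta<\frac12u(\varepsilon)$ if $\Vert x\Vert\le1$, or $\eta<\frac12u(\varepsilon/\Vert x\Vert)$ if $\Vert x\Vert>1$. Let $G$ be a locally compact second countable amenable group that acts Borel strongly on $\mathcal{B}$ via the representation $\pi:G\to\mathcal{L}_1(\mathcal{B},\mathcal{B})$, let $(F_n)$ be a Følner sequence for $G$, and let $\beta(n,\delta)$ be a Følner convergence modulus for $(F_n)$ that is nondecreasing in $n$. Then: (a) if $\Vert x\Vert\le1$, the sequence $(A_nx)$ has at most $\left\lfloor\frac{\Vert x\Vert}{\frac12u(\varepsilon)-\eta}\right\rfloor$ $\varepsilon$-fluctuations at distance $n\mapsto\beta\left(n,\frac{\eta}{3\Vert x\Vert}\right)$; (b) if $\Vert x\Vert>1$, the sequence $(A_nx)$ has at most $\left\lfloor\frac{1}{\frac12u(\varepsilon/\Vert x\Vert)-\eta}\right\rfloor$ $\varepsilon$-fluctuations at distance $n\mapsto\beta\left(n,\frac{\eta}{3}\right)$. Moreover, if $\inf_n\Vert A_nx\Vert\ge L$, then the bound can be sharpened to $\left\lfloor\frac{\Vert x\Vert-L}{\frac12u(\varepsilon)-\eta}\right\rfloor$ in case (a), and to $\left\lfloor\frac{1-L/\Vert x\Vert}{\frac12u(\varepsilon/\Vert x\Vert)-\eta}\right\rfloor$ in case (b).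
   Context: Modulus of uniform convexity: a normed space $(\mathcal{B},\Vert\cdot\Vert)$ is uniformly convex if there is a nondecreasing function $u$, with $u(\varepsilon)>0$ for $\varepsilon>0$, such that for all $x,y\in\mathcal{B}$ with $\Vert x\Vert\le\Vert y\Vert\le1$ and $\Vert x-y\Vert\ge\varepsilon$ one has $\Vert\frac12(x+y)\Vert\le\Vert y\Vert-u(\varepsilon)$; such $u$ is called a modulus of uniform convexity. Actions: $G$ carries left Haar measure, denoted $|\cdot|$ or $dg$, on a $\sigma$-algebra containing the Borel sets. $\mathcal{L}_1(\mathcal{B},\mathcal{B})$ is the set of linear operators on $\mathcal{B}$ of operator norm $1$. $G$ acts Borel strongly on $\mathcal{B}$ via $\pi:G\to\mathcal{L}_1(\mathcal{B},\mathcal{B})$ if $\pi(e)=\mathrm{id}$, $\pi(g)\pi(h)=\pi(gh)$, each $\pi(g)\in\mathcal{L}_1(\mathcal{B},\mathcal{B})$, and for every $x\in\mathcal{B}$ the map $f(g)=\pi(g)x$ is strongly Borel, i.e. $b^*\circ f$ is Borel for all $b^*\in\mathcal{B}^*$ and $f(G)$ is separable. Følner sequences: a sequence $(F_n)$ of compact subsets of $G$ (with $|F_n|>0$) is a Følner sequence if for every $\varepsilon>0$ and compact $K\subset G$ there is $N$ such that for all $n\ge N$ there is a (measurable) $K'\subset K$ with $|K\setminus K'|<|K|\varepsilon$ and $|F_n\Delta kF_n|<|F_n|\varepsilon$ for all $k\in K'$. If $G$ is countable discrete, with counting measure: for every $\varepsilon>0$ and finite $K\subset G$ there is $N$ such that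 $|F_n\Delta kF_n|<|F_n|\varepsilon$ for all $n\ge N$, $k\in K$. Følner convergence modulus: a function $\beta(n,\varepsilon)$ returning an integer $N$ such that, if $G$ is countable discrete, $|F_m\Delta gF_m|<|F_m|\varepsilon$ for all $m\ge N$ and all $g\in F_n$; if $G$ is locally compact second countable, for all $m\ge N$ there is a (measurable) $F_n'\subset F_n$ with $|F_n\setminus F_n'|<|F_n|\varepsilon$ and $|F_m\Delta gF_m|<|F_m|\varepsilon$ for all $g\in F_n'$. Ergodic averages: $A_nx:=\frac{1}{|F_n|}\int_{F_n}\pi(g^{-1})x\,dg$ (Bochner integral). Fluctuations: given $\beta:\mathbb{N}\to\mathbb{N}$, a sequence $(x_n)$ in a metric space has at most $N$ $\varepsilon$-fluctuations at distance $\beta$ if for every finite sequence $n_1<\dots<n_k$ with $n_{i+1}\ge\beta(n_i)$ and $d(x_{n_i},x_{n_{i+1}})\ge\varepsilon$ for all $1\le i<k$, one has $k-1\le N$. (By convention $\beta(n)>n$; a Følner convergence modulus may always be enlarged to satisfy this.) *)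

theory Defs
  imports "HOL-Analysis.Analysis"
begin

text \<open>
  Groups are written additively: \<^class>\<open>topological_group_add\<close> does not assume commutativity,
  so \<open>g + h\<close>, \<open>- g\<close>, \<open>0\<close> stand for \<open>gh\<close>, \<open>g\<inverse>\<close>, \<open>e\<close>, and the left translate \<open>gA\<close> is
  \<open>(+) g ` A\<close>.
\<close>

definition modulus_of_uniform_convexity ::
    "'b::real_normed_vector itself \<Rightarrow> (real \<Rightarrow> real) \<Rightarrow> bool" where
  "modulus_of_uniform_convexity _ u \<longleftrightarrow>
     mono_on {0<..} u \<and> (\<forall>\<epsilon>>0. 0 < u \<epsilon>) \<and>
     (\<forall>\<epsilon>>0. \<forall>x y :: 'b. norm x \<le> norm y \<and> norm y \<le> 1 \<and> \<epsilon> \<le> norm (x - y) \<longrightarrow>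
        norm ((1/2) *\<^sub>R (x + y)) \<le> norm y - u \<epsilon>)"

text \<open>
  The \<open>\<sigma>\<close>-algebra may be larger than the Borel one. The last two conjuncts are the usual regularity
  requirements on a Haar measure.
\<close>

definition left_haar_measure :: "'g::{topological_group_add, t2_space} measure \<Rightarrow> bool" where
  "left_haar_measure \<mu> \<longleftrightarrow>
     space \<mu> = UNIV \<and> sets borel \<subseteq> sets \<mu> \<and> emeasure \<mu> UNIV \<noteq> 0 \<and>
     (\<forall>K. compact K \<longrightarrow> emeasure \<mu> K < \<infinity>) \<and>
     (\<forall>g. \<forall>A\<in>sets \<mu>. (+) g ` A \<in> sets \<mu> \<and> emeasure \<mu> ((+) g ` A) = emeasure \<mu> A) \<and>
     (\<forall>A\<in>sets \<mu>. emeasure \<mu> A = (INF U\<in>{U. open U \<and> A \<subseteq> U}. emeasure \<mu> U)) \<and>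
     (\<forall>U. open U \<longrightarrow> emeasure \<mu> U = (SUP K\<in>{K. compact K \<and> K \<subseteq> U}. emeasure \<mu> K))"

definition ess_bounded_functions :: "'g measure \<Rightarrow> ('g \<Rightarrow> real) set" where
  "ess_bounded_functions \<mu> = {f \<in> borel_measurable \<mu>. \<exists>c. AE t in \<mu>. \<bar>f t\<bar> \<le> c}"

text \<open>Amenability with respect to a Haar measure \<open>\<mu>\<close>: a left-invariant mean on \<open>L\<^sup>\<infinity>(\<mu>)\<close>.\<close>

definition amenable :: "'g::group_add measure \<Rightarrow> bool" where
  "amenable \<mu> \<longleftrightarrow> (\<exists>\<Lambda> :: ('g \<Rightarrow> real) \<Rightarrow> real.
     (\<forall>f\<in>ess_bounded_functions \<mu>. \<forall>h\<in>ess_bounded_functions \<mu>. \<Lambda> (\<lambda>t. f t + h t) = \<Lambda> f + \<Lambda> h) \<and>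
     (\<forall>f\<in>ess_bounded_functions \<mu>. \<forall>c. \<Lambda> (\<lambda>t. c * f t) = c * \<Lambda> f) \<and>
     (\<forall>f\<in>ess_bounded_functions \<mu>. (AE t in \<mu>. 0 \<le> f t) \<longrightarrow> 0 \<le> \<Lambda> f) \<and>
     (\<forall>f\<in>ess_bounded_functions \<mu>. \<forall>h\<in>ess_bounded_functions \<mu>.
        (AE t in \<mu>. f t = h t) \<longrightarrow> \<Lambda> f = \<Lambda> h) \<and>
     \<Lambda> (\<lambda>_. 1) = 1 \<and>
     (\<forall>f\<in>ess_bounded_functions \<mu>. \<forall>g. \<Lambda> (\<lambda>t. f (g + t)) = \<Lambda> f))"

definition acts_borel_strongly ::
    "('g::topological_group_add \<Rightarrow> 'b::real_normed_vector \<Rightarrow>\<^sub>L 'b) \<Rightarrow> bool" where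
  "acts_borel_strongly \<pi> \<longleftrightarrow>
     \<pi> 0 = id_blinfun \<and> (\<forall>g h. \<pi> g o\<^sub>L \<pi> h = \<pi> (g + h)) \<and> (\<forall>g. norm (\<pi> g) = 1) \<and>
     (\<forall>x. (\<forall>\<phi> :: 'b \<Rightarrow>\<^sub>L real. (\<lambda>g. blinfun_apply \<phi> (blinfun_apply (\<pi> g) x)) \<in> borel_measurable borel) \<and>
          separable_space (top_of_set (range (\<lambda>g. blinfun_apply (\<pi> g) x))))"

text \<open>
  The test sets \<open>K\<close> have positive measure: for a null set the strict inequality
  \<open>|K - K'| < |K| \<epsilon>\<close> can never hold.
\<close>

definition folner_sequence ::
    "'g::{topological_group_add, t2_space} measure \<Rightarrow> (nat \<Rightarrow> 'g set) \<Rightarrow> bool" where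
  "folner_sequence \<mu> F \<longleftrightarrow>
     (\<forall>n. compact (F n) \<and> 0 < measure \<mu> (F n)) \<and>
     (\<forall>\<epsilon>>0. \<forall>K. compact K \<and> 0 < measure \<mu> K \<longrightarrow>
        (\<exists>N. \<forall>n\<ge>N. \<exists>K'\<in>sets \<mu>. K' \<subseteq> K \<and> measure \<mu> (K - K') < measure \<mu> K * \<epsilon> \<and>
           (\<forall>k\<in>K'. measure \<mu> (sym_diff (F n) ((+) k ` F n)) < measure \<mu> (F n) * \<epsilon>)))"

definition folner_convergence_modulus ::
    "'g::{topological_group_add, t2_space} measure \<Rightarrow> (nat \<Rightarrow> 'g set) \<Rightarrow> (nat \<Rightarrow> real \<Rightarrow> nat) \<Rightarrow> bool"
  where
  "folner_convergence_modulus \<mu> F \<beta> \<longleftrightarrow>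
     (\<forall>n. \<forall>\<epsilon>>0. \<forall>m\<ge>\<beta> n \<epsilon>. \<exists>F'\<in>sets \<mu>. F' \<subseteq> F n \<and>
        measure \<mu> (F n - F') < measure \<mu> (F n) * \<epsilon> \<and>
        (\<forall>g\<in>F'. measure \<mu> (sym_diff (F m) ((+) g ` F m)) < measure \<mu> (F m) * \<epsilon>))"

text \<open>
  For countable discrete groups the customary definitions have no exceptional sets. They imply
  the general ones:
\<close>

lemma folner_sequence_pointwiseI:
  assumes "left_haar_measure \<mu>"
    and "\<And>n. compact (F n) \<and> 0 < measure \<mu> (F n)"
    and "\<And>\<epsilon> K. 0 < \<epsilon> \<Longrightarrow> compact K \<Longrightarrow>
      \<exists>N. \<forall>n\<ge>N. \<forall>k\<in>K. measure \<mu> (sym_diff (F n) ((+) k ` F n)) < measure \<mu> (F n) * \<epsilon>"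
  shows "folner_sequence \<mu> F"
proof -
  have sets: "K \<in> sets \<mu>" if "compact K" for K
  proof -
    have "sets borel \<subseteq> sets \<mu>"
      using assms(1) unfolding left_haar_measure_def by (elim conjE)
    then show ?thesis
      using borel_compact[OF that] by auto
  qed
  have "\<exists>N. \<forall>n\<ge>N. \<exists>K'\<in>sets \<mu>. K' \<subseteq> K \<and> measure \<mu> (K - K') < measure \<mu> K * \<epsilon> \<and>
      (\<forall>k\<in>K'. measure \<mu> (sym_diff (F n) ((+) k ` F n)) < measure \<mu> (F n) * \<epsilon>)"
    if "0 < \<epsilon>" "compact K" "0 < measure \<mu> K" for \<epsilon> K
  proof -
    have "measure \<mu> (K - K) < measure \<mu> K * \<epsilon>"
      using that by simp
    then show ?thesis
      using assms(3)[OF that(1,2)] sets[OF that(2)] by (meson order_refl)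
  qed
  then show ?thesis
    unfolding folner_sequence_def using assms(2) by (intro conjI allI impI) auto
qed

lemma folner_convergence_modulus_pointwiseI:
  assumes "left_haar_measure \<mu>" and "folner_sequence \<mu> F"
    and "\<And>n \<epsilon> m g. 0 < \<epsilon> \<Longrightarrow> \<beta> n \<epsilon> \<le> m \<Longrightarrow> g \<in> F n \<Longrightarrow>
      measure \<mu> (sym_diff (F m) ((+) g ` F m)) < measure \<mu> (F m) * \<epsilon>"
  shows "folner_convergence_modulus \<mu> F \<beta>"
proof -
  have F: "F n \<in> sets \<mu>" "0 < measure \<mu> (F n)" for n
  proof -
    have "sets borel \<subseteq> sets \<mu>"
      using assms(1) unfolding left_haar_measure_def by (elim conjE)
    moreover have "\<forall>n. compact (F n) \<and> 0 < measure \<mu> (F n)"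
      using assms(2) unfolding folner_sequence_def by (elim conjE)
    ultimately show "F n \<in> sets \<mu>" "0 < measure \<mu> (F n)"
      using borel_compact[of "F n"] by auto
  qed
  show ?thesis
    unfolding folner_convergence_modulus_def
  proof (intro allI impI)
    fix n m \<epsilon> assume "(0::real) < \<epsilon>" "\<beta> n \<epsilon> \<le> m"
    then show "\<exists>F'\<in>sets \<mu>. F' \<subseteq> F n \<and> measure \<mu> (F n - F') < measure \<mu> (F n) * \<epsilon> \<and>
        (\<forall>g\<in>F'. measure \<mu> (sym_diff (F m) ((+) g ` F m)) < measure \<mu> (F m) * \<epsilon>)"
      using F assms(3) by (intro bexI[of _ "F n"]) auto
  qed
qed

text \<open>
  The library's \<^const>\<open>has_bochner_integral\<close> requires a second countable codomain. This is its definition verbatim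
  for an arbitrary normed space; the \<open>L\<^sup>1\<close>-approximation by simple functions forces \<open>f\<close> to be
  almost everywhere separably valued.
\<close>

inductive bochner_integral_is :: "'a measure \<Rightarrow> ('a \<Rightarrow> 'b) \<Rightarrow> 'b::real_normed_vector \<Rightarrow> bool"
  for M f v where
  "f \<in> borel_measurable M \<Longrightarrow>
   (\<And>i. Bochner_Integration.simple_bochner_integrable M (s i)) \<Longrightarrow>
   (\<lambda>i. \<integral>\<^sup>+t. norm (f t - s i t) \<partial>M) \<longlonglongrightarrow> 0 \<Longrightarrow>
   (\<lambda>i. Bochner_Integration.simple_bochner_integral M (s i)) \<longlonglongrightarrow> v \<Longrightarrow>
   bochner_integral_is M f v"

lemma bochner_integral_is_iff_has_bochner_integral:
  fixes f :: "'a \<Rightarrow> 'b::{real_normed_vector, second_countable_topology}"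
  shows "bochner_integral_is M f v \<longleftrightarrow> has_bochner_integral M f v"
  unfolding bochner_integral_is.simps has_bochner_integral.simps ..

definition bochner_integral_on :: "'a measure \<Rightarrow> 'a set \<Rightarrow> ('a \<Rightarrow> 'b) \<Rightarrow> 'b::real_normed_vector" where
  "bochner_integral_on M A f = (THE v. bochner_integral_is M (\<lambda>t. indicator A t *\<^sub>R f t) v)"

definition ergodic_average ::
    "'g::group_add measure \<Rightarrow> ('g \<Rightarrow> 'b::real_normed_vector \<Rightarrow>\<^sub>L 'b) \<Rightarrow> (nat \<Rightarrow> 'g set) \<Rightarrow> nat \<Rightarrow> 'b \<Rightarrow> 'b"
  where
  "ergodic_average \<mu> \<pi> F n x =
     (1 / measure \<mu> (F n)) *\<^sub>R bochner_integral_on \<mu> (F n) (\<lambda>g. blinfun_apply (\<pi> (- g)) x)"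

text \<open>The bound \<open>N\<close> is an integer so that no truncation occurs when it is a floor.\<close>

definition at_most_fluctuations ::
    "int \<Rightarrow> real \<Rightarrow> (nat \<Rightarrow> nat) \<Rightarrow> (nat \<Rightarrow> 'a::metric_space) \<Rightarrow> bool" where
  "at_most_fluctuations N \<epsilon> \<beta> X \<longleftrightarrow>
     (\<forall>ns :: nat list. ns \<noteq> [] \<and> sorted_wrt (<) ns \<and>
        (\<forall>i. Suc i < length ns \<longrightarrow>
           \<beta> (ns ! i) \<le> ns ! Suc i \<and> \<epsilon> \<le> dist (X (ns ! i)) (X (ns ! Suc i))) \<longrightarrow>
        int (length ns) - 1 \<le> N)"

end

theory Submission
  imports Defs
begin

text \<open>
  If \<open>m \<ge> \<beta> n \<delta>\<close>, then \<open>A\<^sub>m\<close> almost absorbs \<open>A\<^sub>n\<close>: \<open>A\<^sub>m (\<pi> (- h) x)\<close> is the average of the orbit over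
  the translate \<open>h + F m\<close>, which differs little from \<open>A\<^sub>m x\<close> for most \<open>h \<in> F n\<close>, so averaging over \<open>h\<close>
  gives \<open>\<parallel>A\<^sub>m x - A\<^sub>m (A\<^sub>n x)\<parallel> \<le> 3 \<delta> \<parallel>x\<parallel>\<close>. If \<open>A\<^sub>n x\<close> and \<open>A\<^sub>m x\<close> are \<open>\<epsilon>\<close> apart, uniform convexity makes
  their midpoint shorter by \<open>u \<epsilon>\<close>, and every later \<open>A\<^sub>k x\<close> is close to \<open>A\<^sub>k\<close> of that midpoint; up to the
  errors, \<open>\<parallel>A\<^sub>k x\<parallel> \<le> \<parallel>A\<^sub>n x\<parallel> - (u \<epsilon> - 2 \<eta>)\<close>. Thus every two fluctuations cost \<open>u \<epsilon> - 2 \<eta>\<close>.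

  The space need not be separable, so Bochner integrals are handled through Pettis' theorem:
  they are determined by the integrals of their compositions with continuous functionals, and these
  compositions are ordinary real integrals.
\<close>

section \<open>Norming functionals\<close>

definition sublinear_functional :: "('a::real_vector \<Rightarrow> real) \<Rightarrow> bool" where
  "sublinear_functional p \<longleftrightarrow>
     (\<forall>x y. p (x + y) \<le> p x + p y) \<and> (\<forall>c>0. \<forall>x. p (c *\<^sub>R x) \<le> c * p x) \<and> p 0 = 0"

lemma sublinear_functionalD:
  assumes "sublinear_functional p"
  shows "p (x + y) \<le> p x + p y" and "0 \<le> c \<Longrightarrow> p (c *\<^sub>R x) = c * p x" and "p 0 = 0"
    and "- p (- x) \<le> p x"
proof -
  show add: "p (x + y) \<le> p x + p y" for x y
    using assms unfolding sublinear_functional_def by blast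
  show p0: "p 0 = 0"
    using assms unfolding sublinear_functional_def by blast
  show "- p (- x) \<le> p x"
    using add[of x "- x"] p0 by simp
  have le: "p (c *\<^sub>R x) \<le> c * p x" if "0 < c" for c x
    using assms that unfolding sublinear_functional_def by blast
  show "p (c *\<^sub>R x) = c * p x" if "0 \<le> c"
  proof (cases "c = 0")
    case False
    with that have c: "0 < c" by simp
    have "p x \<le> (1 / c) * p (c *\<^sub>R x)"
      using le[of "1 / c" "c *\<^sub>R x"] c by simp
    then have "c * p x \<le> p (c *\<^sub>R x)"
      using c by (simp add: field_simps)
    with le[OF c, of x] show ?thesis by simp
  qed (use p0 in simp)
qed

lemma sublinear_functional_norm: "sublinear_functional norm"
  by (auto simp: sublinear_functional_def norm_triangle_ineq)

text \<open>
  The infimum in the proof is the largest \<open>q\<close> with these properties. As \<open>- p y \<le> p (- y)\<close>, a minimal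
  sublinear functional is its own witness, hence odd, hence linear.
\<close>

lemma sublinear_functional_dent:
  assumes p: "sublinear_functional p"
  obtains q where "sublinear_functional q" "q \<le> p" "q (- y) \<le> - p y"
proof -
  note D = sublinear_functionalD[OF p]
  define r where "r x t = p (x + t *\<^sub>R y) - t * p y" for x t
  define q where "q x = (INF t\<in>{0..}. r x t)" for x
  have low: "- p (- x) \<le> r x t" if "0 \<le> t" for x t
    using D(1)[of "x + t *\<^sub>R y" "- x"] D(2)[OF that, of y] by (simp add: r_def)
  have qle: "q x \<le> r x t" if "0 \<le> t" for x t
    unfolding q_def using low that by (intro cINF_lower bdd_belowI2[where m = "- p (- x)"]) auto
  have qge: "m \<le> q x" if "\<And>t. 0 \<le> t \<Longrightarrow> m \<le> r x t" for m x
    unfolding q_def using that by (intro cINF_greatest) auto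
  have "q (x + x') \<le> q x + q x'" for x x'
  proof -
    have *: "q (x + x') \<le> r x s + r x' t" if "0 \<le> s" "0 \<le> t" for s t
      using qle[of "s + t" "x + x'"] D(1)[of "x + s *\<^sub>R y" "x' + t *\<^sub>R y"] that
      by (simp add: r_def algebra_simps)
    have "q (x + x') - r x s \<le> q x'" if "0 \<le> s" for s
      using *[OF that] by (intro qge) (simp add: algebra_simps)
    then have "q (x + x') - q x' \<le> q x"
      by (intro qge) (simp add: algebra_simps)
    then show ?thesis by simp
  qed
  moreover have "q (c *\<^sub>R x) \<le> c * q x" if "0 < c" for c x
  proof -
    have "q (c *\<^sub>R x) / c \<le> r x t" if "0 \<le> t" for t
    proof -
      have "q (c *\<^sub>R x) \<le> p (c *\<^sub>R (x + t *\<^sub>R y)) - c * t * p y"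
        using qle[of "c * t" "c *\<^sub>R x"] \<open>0 < c\<close> that by (simp add: r_def algebra_simps)
      also have "\<dots> = c * r x t"
        using D(2)[of c "x + t *\<^sub>R y"] \<open>0 < c\<close> by (simp add: r_def algebra_simps)
      finally show ?thesis
        using \<open>0 < c\<close> by (simp add: field_simps)
    qed
    then have "q (c *\<^sub>R x) / c \<le> q x" by (rule qge)
    then show ?thesis using \<open>0 < c\<close> by (simp add: field_simps)
  qed
  moreover have "q 0 = 0"
  proof (rule antisym)
    show "q 0 \<le> 0" using qle[of 0 0] D(3) by (simp add: r_def)
    show "0 \<le> q 0" by (rule qge) (simp add: r_def D(2))
  qed
  ultimately have "sublinear_functional q"
    unfolding sublinear_functional_def by blast
  moreover have "q \<le> p"
    using qle[of 0] by (auto simp: le_fun_def r_def)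
  moreover have "q (- y) \<le> - p y"
    using qle[of 1 "- y"] D(3) by (simp add: r_def)
  ultimately show ?thesis by (rule that)
qed

lemma sublinear_functional_INF:
  assumes "C \<noteq> {}" and sub: "\<And>p. p \<in> C \<Longrightarrow> sublinear_functional p"
    and le: "\<And>p. p \<in> C \<Longrightarrow> p \<le> q"
    and chain: "\<And>p p'. p \<in> C \<Longrightarrow> p' \<in> C \<Longrightarrow> p \<le> p' \<or> p' \<le> p"
  shows "sublinear_functional (\<lambda>x. INF p\<in>C. p x)" and "\<And>p. p \<in> C \<Longrightarrow> (\<lambda>x. INF p\<in>C. p x) \<le> p"
proof -
  define v where "v x = (INF p\<in>C. p x)" for x
  have low: "- q (- x) \<le> p x" if "p \<in> C" for p x
    using sublinear_functionalD(4)[OF sub[OF that], of x] le_funD[OF le[OF that], of "- x"] by simp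
  have vle: "v x \<le> p x" if "p \<in> C" for p x
    unfolding v_def using low that by (intro cINF_lower bdd_belowI2[where m = "- q (- x)"]) auto
  have vge: "m \<le> v x" if "\<And>p. p \<in> C \<Longrightarrow> m \<le> p x" for m x
    unfolding v_def using that \<open>C \<noteq> {}\<close> by (intro cINF_greatest) auto
  have "v (x + y) \<le> v x + v y" for x y
  proof -
    have *: "v (x + y) \<le> p x + p' y" if pp: "p \<in> C" "p' \<in> C" for p p'
    proof -
      obtain r where r: "r \<in> C" "r \<le> p" "r \<le> p'"
        using chain[OF pp] pp by blast
      have "v (x + y) \<le> r x + r y"
        using vle[OF r(1)] sublinear_functionalD(1)[OF sub[OF r(1)]] order_trans by blast
      also have "\<dots> \<le> p x + p' y"
        using r(2,3) by (intro add_mono) (auto simp: le_fun_def)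
      finally show ?thesis .
    qed
    have "v (x + y) - p x \<le> v y" if "p \<in> C" for p
      using *[OF that] by (intro vge) (simp add: algebra_simps)
    then have "v (x + y) - v y \<le> v x"
      by (intro vge) (simp add: algebra_simps)
    then show ?thesis by simp
  qed
  moreover have "v (c *\<^sub>R x) \<le> c * v x" if "0 < c" for c x
  proof -
    have "v (c *\<^sub>R x) / c \<le> v x"
    proof (rule vge)
      fix p assume "p \<in> C"
      then have "v (c *\<^sub>R x) \<le> c * p x"
        using vle[of p "c *\<^sub>R x"] sublinear_functionalD(2)[OF sub, of p c x] that by simp
      then show "v (c *\<^sub>R x) / c \<le> p x"
        using that by (simp add: field_simps)
    qed
    then show ?thesis using that by (simp add: field_simps)
  qed
  moreover have "v 0 = 0"
  proof -
    have "(\<lambda>p. p 0) ` C = {0}"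
      using \<open>C \<noteq> {}\<close> sublinear_functionalD(3)[OF sub] by force
    then show ?thesis by (simp add: v_def)
  qed
  ultimately have "sublinear_functional v"
    unfolding sublinear_functional_def by blast
  then show "sublinear_functional (\<lambda>x. INF p\<in>C. p x)"
    unfolding v_def .
  show "(\<lambda>x. INF p\<in>C. p x) \<le> p" if "p \<in> C" for p
    using vle[OF that] by (simp add: le_fun_def v_def)
qed

lemma linear_below_sublinear_functional:
  assumes q: "sublinear_functional q"
  obtains f :: "'a::real_vector \<Rightarrow> real" where "linear f" "f \<le> q"
proof -
  define A where "A = {p. sublinear_functional p \<and> p \<le> q}"
  have "\<exists>m\<in>A. \<forall>a\<in>A. a \<le> m \<longrightarrow> a = m"
  proof (rule predicate_Zorn[where P = "\<lambda>p p'. p' \<le> p"])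
    show "partial_order_on A (relation_of (\<lambda>p p'. p' \<le> p) A)"
      by (rule partial_order_on_relation_ofI) auto
  next
    fix C assume C: "C \<in> Chains (relation_of (\<lambda>p p'. p' \<le> p) A)"
    show "\<exists>v\<in>A. \<forall>a\<in>C. v \<le> a"
    proof (cases "C = {}")
      case True
      then show ?thesis using q by (auto simp: A_def)
    next
      case False
      have C': "p \<in> A \<and> p' \<in> A \<and> (p \<le> p' \<or> p' \<le> p)" if "p \<in> C" "p' \<in> C" for p p'
        using C that unfolding Chains_def relation_of_def by blast
      note I = sublinear_functional_INF[OF False, of q]
      have 1: "sublinear_functional (\<lambda>x. INF p\<in>C. p x)"
        by (rule I) (use C' in \<open>auto simp: A_def\<close>)
      have 2: "(\<lambda>x. INF p\<in>C. p x) \<le> p" if "p \<in> C" for p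
        by (rule I) (use C' that in \<open>auto simp: A_def\<close>)
      have "(\<lambda>x. INF p\<in>C. p x) \<in> A"
        using 1 2 False C' unfolding A_def by (blast intro: order_trans)
      then show ?thesis using 2 by blast
    qed
  qed
  then obtain m where m: "m \<in> A" and min: "\<And>a. a \<in> A \<Longrightarrow> a \<le> m \<Longrightarrow> a = m"
    by blast
  then have sub: "sublinear_functional m" and "m \<le> q"
    by (auto simp: A_def)
  note D = sublinear_functionalD[OF sub]
  have neg: "m (- y) = - m y" for y
  proof -
    obtain p where p: "sublinear_functional p" "p \<le> m" "p (- y) \<le> - m y"
      using sublinear_functional_dent[OF sub] .
    then have "p = m" using \<open>m \<le> q\<close> by (intro min) (auto simp: A_def)
    then show ?thesis using p(3) D(4)[of "- y"] by simp
  qed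
  have "m (x + y) = m x + m y" for x y
    using D(1)[of x y] D(1)[of "- x" "- y"] neg[of "x + y"] neg[of x] neg[of y] by simp
  moreover have "m (c *\<^sub>R x) = c * m x" for c x
    using D(2)[of c x] D(2)[of "- c" x] neg[of "c *\<^sub>R x"] by (cases "0 \<le> c") auto
  ultimately have "linear m"
    by (intro linearI) auto
  then show ?thesis using \<open>m \<le> q\<close> by (rule that)
qed

lemma norming_functional:
  fixes y :: "'b::real_normed_vector"
  obtains \<phi> :: "'b \<Rightarrow>\<^sub>L real" where "norm \<phi> \<le> 1" "blinfun_apply \<phi> y = norm y"
proof -
  obtain q :: "'b \<Rightarrow> real" where q: "sublinear_functional q" "q \<le> norm" "q (- y) \<le> - norm y"
    using sublinear_functional_dent[OF sublinear_functional_norm] .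
  obtain f where f: "linear f" "f \<le> q"
    using linear_below_sublinear_functional[OF q(1)] .
  interpret linear f by fact
  have le: "f x \<le> norm x" for x
    using f(2) q(2) by (meson le_fun_def order_trans)
  have bound: "norm (f x) \<le> 1 * norm x" for x
    using le[of x] le[of "- x"] by (simp add: neg abs_le_iff)
  have bl: "bounded_linear f"
    using bound by (intro bounded_linear_intro[where K = 1]) (auto simp: add scale)
  have "f (- y) \<le> - norm y"
    using f(2) q(3) by (meson le_fun_def order_trans)
  then have "f y = norm y"
    using le[of y] by (simp add: neg)
  moreover have "norm (Blinfun f) \<le> 1"
    using bound by (intro norm_blinfun_bound) (auto simp: bounded_linear_Blinfun_apply[OF bl])
  ultimately show ?thesis
    using that[of "Blinfun f"] by (simp add: bounded_linear_Blinfun_apply[OF bl])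
qed

section \<open>The Bochner integral without second countability\<close>

lemma borel_measurable_norm_diff_weak:
  fixes f :: "'a \<Rightarrow> 'b::real_normed_vector"
  assumes weak: "\<And>\<phi> :: 'b \<Rightarrow>\<^sub>L real. (\<lambda>t. blinfun_apply \<phi> (f t)) \<in> borel_measurable M"
    and D: "countable D" "f ` space M \<subseteq> closure D"
  shows "(\<lambda>t. norm (f t - d)) \<in> borel_measurable M"
proof -
  have "\<exists>\<phi> :: 'b \<Rightarrow>\<^sub>L real. norm \<phi> \<le> 1 \<and> blinfun_apply \<phi> (y - d) = norm (y - d)" for y
    using norming_functional[of "y - d"] by metis
  then obtain \<phi> :: "'b \<Rightarrow> 'b \<Rightarrow>\<^sub>L real"
    where \<phi>: "\<And>y. norm (\<phi> y) \<le> 1" "\<And>y. blinfun_apply (\<phi> y) (y - d) = norm (y - d)"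
    by metis
  have \<phi>_le: "blinfun_apply (\<phi> y) z \<le> norm z" for y z
  proof -
    have "\<bar>blinfun_apply (\<phi> y) z\<bar> \<le> norm (\<phi> y) * norm z"
      using norm_blinfun[of "\<phi> y" z] by simp
    also have "\<dots> \<le> 1 * norm z"
      by (intro mult_right_mono \<phi>) simp
    finally show ?thesis by simp
  qed
  have "{t \<in> space M. norm (f t - d) \<le> a} =
      {t \<in> space M. \<forall>y\<in>D. blinfun_apply (\<phi> y) (f t) - blinfun_apply (\<phi> y) d \<le> a}" for a
  proof (intro Collect_cong conj_cong refl iffI ballI)
    fix t y assume "norm (f t - d) \<le> a"
    then show "blinfun_apply (\<phi> y) (f t) - blinfun_apply (\<phi> y) d \<le> a"
      using \<phi>_le[of y "f t - d"] by (simp add: blinfun.diff_right)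
  next
    fix t assume "t \<in> space M"
      and *: "\<forall>y\<in>D. blinfun_apply (\<phi> y) (f t) - blinfun_apply (\<phi> y) d \<le> a"
    show "norm (f t - d) \<le> a"
    proof (rule field_le_epsilon)
      fix e :: real assume "0 < e"
      then obtain y where y: "y \<in> D" "dist y (f t) < e / 2"
        using D(2) \<open>t \<in> space M\<close> closure_approachable[of "f t" D] half_gt_zero by blast
      have "norm (f t - d) \<le> norm (y - f t) + norm (y - d)"
        using dist_triangle3[of "f t" d y] by (simp add: dist_norm)
      also have "norm (y - d) = blinfun_apply (\<phi> y) (y - f t) + (blinfun_apply (\<phi> y) (f t) - blinfun_apply (\<phi> y) d)"
        unfolding \<phi>(2)[symmetric] by (simp add: blinfun.diff_right)
      also have "\<dots> \<le> norm (y - f t) + a"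
        using \<phi>_le[of y "y - f t"] * y(1) by (intro add_mono) auto
      finally show "norm (f t - d) \<le> a + e"
        using y(2) by (simp add: dist_norm)
    qed
  qed
  moreover have "{t \<in> space M. \<forall>y\<in>D. blinfun_apply (\<phi> y) (f t) - blinfun_apply (\<phi> y) d \<le> a} \<in> sets M" for a
  proof -
    have "{t \<in> space M. a < blinfun_apply (\<phi> y) (f t) - blinfun_apply (\<phi> y) d} \<in> sets M" for y
      using weak[of "\<phi> y"] by measurable
    then have "space M - (\<Union>y\<in>D. {t \<in> space M. a < blinfun_apply (\<phi> y) (f t) - blinfun_apply (\<phi> y) d}) \<in> sets M"
      using D(1) by (intro sets.Diff sets.countable_UN') auto
    also have "space M - (\<Union>y\<in>D. {t \<in> space M. a < blinfun_apply (\<phi> y) (f t) - blinfun_apply (\<phi> y) d}) =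
        {t \<in> space M. \<forall>y\<in>D. blinfun_apply (\<phi> y) (f t) - blinfun_apply (\<phi> y) d \<le> a}"
      by (auto simp: not_less)
    finally show ?thesis .
  qed
  ultimately show ?thesis
    unfolding borel_measurable_iff_le by simp
qed

lemma pettis_measurability:
  fixes f :: "'a \<Rightarrow> 'b::real_normed_vector"
  assumes weak: "\<And>\<phi> :: 'b \<Rightarrow>\<^sub>L real. (\<lambda>t. blinfun_apply \<phi> (f t)) \<in> borel_measurable M"
    and D: "countable D" "f ` space M \<subseteq> closure D"
  shows "f \<in> borel_measurable M"
proof (rule borel_measurableI)
  note [measurable] = borel_measurable_norm_diff_weak[OF assms]
  fix S :: "'b set" assume "open S"
  define I where "I = {(y, n). y \<in> D \<and> ball y (1 / Suc n) \<subseteq> S}"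
  have "countable I"
    by (rule countable_subset[of _ "D \<times> UNIV"]) (auto simp: I_def D(1))
  have "f -` S \<inter> space M = (\<Union>(y, n)\<in>I. {t \<in> space M. norm (f t - y) < 1 / Suc n})"
  proof (intro equalityI subsetI)
    fix t assume t: "t \<in> f -` S \<inter> space M"
    then obtain e where e: "0 < e" "ball (f t) e \<subseteq> S"
      using \<open>open S\<close> openE by blast
    obtain n where n: "inverse (real (Suc n)) < e / 2"
      using reals_Archimedean[of "e / 2"] e(1) by auto
    obtain y where y: "y \<in> D" "dist y (f t) < 1 / Suc n"
      using D(2) t closure_approachable[of "f t" D] by (metis IntD2 image_subset_iff of_nat_0_less_iff zero_less_Suc zero_less_divide_1_iff)
    have "ball y (1 / Suc n) \<subseteq> ball (f t) e"
    proof
      fix z assume "z \<in> ball y (1 / Suc n)"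
      then have "dist (f t) z < 1 / Suc n + 1 / Suc n"
        using y(2) dist_triangle[of "f t" z y] by (simp add: dist_commute)
      then show "z \<in> ball (f t) e"
        using n by (simp add: inverse_eq_divide)
    qed
    then have "(y, n) \<in> I" using y(1) e(2) by (auto simp: I_def)
    then show "t \<in> (\<Union>(y, n)\<in>I. {t \<in> space M. norm (f t - y) < 1 / Suc n})"
      using y(2) t by (auto simp: dist_norm norm_minus_commute intro!: bexI[of _ "(y, n)"])
  qed (auto simp: I_def dist_norm norm_minus_commute subset_iff)
  also have "\<dots> \<in> sets M"
    using \<open>countable I\<close> by (intro sets.countable_UN') auto
  finally show "f -` S \<inter> space M \<in> sets M" .
qed

lemma borel_measurable_norm_diff_simple_function:
  fixes f s :: "'a \<Rightarrow> 'b::real_normed_vector"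
  assumes [measurable]: "f \<in> borel_measurable M" and s: "simple_function M s"
  shows "(\<lambda>t. norm (f t - s t)) \<in> borel_measurable M"
proof (rule measurable_compose_countable'[where I = "s ` space M" and g = s])
  have [measurable]: "(\<lambda>y. norm (y - c)) \<in> borel_measurable borel" for c :: 'b
    by (intro borel_measurable_continuous_onI continuous_intros)
  show "(\<lambda>t. norm (f t - c)) \<in> borel_measurable M" for c
    by measurable
  show "s \<in> measurable M (count_space (s ` space M))"
    using s by (auto simp: simple_function_def measurable_count_space_eq2)
  show "countable (s ` space M)"
    using s by (auto simp: simple_function_def intro: countable_finite)
qed

lemma simple_bochner_integral_dist_le:
  fixes f :: "'a \<Rightarrow> 'b::real_normed_vector"
  assumes f: "f \<in> borel_measurable M"
    and s: "Bochner_Integration.simple_bochner_integrable M s"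
    and t: "Bochner_Integration.simple_bochner_integrable M t"
  shows "ennreal (norm (Bochner_Integration.simple_bochner_integral M s - Bochner_Integration.simple_bochner_integral M t)) \<le>
    (\<integral>\<^sup>+ x. norm (f x - s x) \<partial>M) + (\<integral>\<^sup>+ x. norm (f x - t x) \<partial>M)"
    (is "ennreal (norm (?s - ?t)) \<le> ?S + ?T")
proof -
  have [measurable]: "(\<lambda>x. norm (f x - s x)) \<in> borel_measurable M" "(\<lambda>x. norm (f x - t x)) \<in> borel_measurable M"
    using s t f by (auto intro: borel_measurable_norm_diff_simple_function
        elim: Bochner_Integration.simple_bochner_integrable.cases)
  have "ennreal (norm (?s - ?t)) = norm (Bochner_Integration.simple_bochner_integral M (\<lambda>x. s x - t x))"
    using s t by (subst simple_bochner_integral_diff) auto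
  also have "\<dots> \<le> Bochner_Integration.simple_bochner_integral M (\<lambda>x. norm (s x - t x))"
    using simple_bochner_integrable_compose2[of "(-)" M "s" "t"] s t
    by (auto intro!: simple_bochner_integral_norm_bound)
  also have "\<dots> = (\<integral>\<^sup>+x. norm (s x - t x) \<partial>M)"
    using simple_bochner_integrable_compose2[of "\<lambda>x y. norm (x - y)" M "s" "t"] s t
    by (auto intro!: simple_bochner_integral_eq_nn_integral)
  also have "\<dots> \<le> (\<integral>\<^sup>+x. ennreal (norm (f x - s x)) + ennreal (norm (f x - t x)) \<partial>M)"
  proof (rule nn_integral_mono)
    fix x
    have "norm (s x - t x) \<le> norm (f x - s x) + norm (f x - t x)"
      by (metis dual_order.refl norm_diff_triangle_le norm_minus_commute)
    then show "ennreal (norm (s x - t x)) \<le> ennreal (norm (f x - s x)) + ennreal (norm (f x - t x))"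
      by (simp flip: ennreal_plus)
  qed
  also have "\<dots> = ?S + ?T"
    by (rule nn_integral_add) auto
  finally show ?thesis .
qed

lemma bochner_integral_is_exists_of_simple:
  fixes f :: "'a \<Rightarrow> 'b::banach"
  assumes f: "f \<in> borel_measurable M"
    and s: "\<And>i. Bochner_Integration.simple_bochner_integrable M (s i)"
    and lim: "(\<lambda>i. \<integral>\<^sup>+t. norm (f t - s i t) \<partial>M) \<longlonglongrightarrow> 0"
  shows "\<exists>v. bochner_integral_is M f v"
proof -
  have "Cauchy (\<lambda>i. Bochner_Integration.simple_bochner_integral M (s i))"
  proof (rule metric_CauchyI)
    fix e :: real assume "0 < e"
    then have "\<forall>\<^sub>F i in sequentially. (\<integral>\<^sup>+t. norm (f t - s i t) \<partial>M) < ennreal (e / 2)"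
      using lim by (intro order_tendstoD) (auto simp: order_tendsto_iff)
    then obtain N where N: "\<And>i. N \<le> i \<Longrightarrow> (\<integral>\<^sup>+t. norm (f t - s i t) \<partial>M) < ennreal (e / 2)"
      unfolding eventually_sequentially by blast
    have "dist (Bochner_Integration.simple_bochner_integral M (s i)) (Bochner_Integration.simple_bochner_integral M (s j)) < e"
      if "N \<le> i" "N \<le> j" for i j
    proof -
      have "ennreal (dist (Bochner_Integration.simple_bochner_integral M (s i)) (Bochner_Integration.simple_bochner_integral M (s j)))
          < ennreal (e / 2) + ennreal (e / 2)"
        unfolding dist_norm
        by (rule le_less_trans[OF simple_bochner_integral_dist_le[OF f s s]])
          (intro add_strict_mono N that)
      also have "\<dots> = ennreal e"
        using \<open>0 < e\<close> by (simp flip: ennreal_plus)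
      finally show ?thesis
        by (simp add: ennreal_less_iff)
    qed
    then show "\<exists>N. \<forall>i\<ge>N. \<forall>j\<ge>N. dist (Bochner_Integration.simple_bochner_integral M (s i))
        (Bochner_Integration.simple_bochner_integral M (s j)) < e"
      by blast
  qed
  then obtain v where "(\<lambda>i. Bochner_Integration.simple_bochner_integral M (s i)) \<longlonglongrightarrow> v"
    using Cauchy_convergent convergent_def by blast
  then show ?thesis
    using bochner_integral_is.intros[OF f s lim] by blast
qed

lemma bochner_integral_is_exists:
  fixes f :: "'a \<Rightarrow> 'b::banach"
  assumes f[measurable]: "f \<in> borel_measurable M"
    and D: "countable D" "f ` space M \<subseteq> closure D"
    and bound: "\<And>t. norm (f t) \<le> C"
    and A[measurable]: "A \<in> sets M" and fin: "emeasure M A < \<infinity>"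
    and supp: "\<And>t. t \<notin> A \<Longrightarrow> f t = 0"
  shows "\<exists>v. bochner_integral_is M f v"
proof -
  define e where "e k = (case k of 0 \<Rightarrow> 0 | Suc j \<Rightarrow> from_nat_into (insert 0 D) j)" for k
  have e0[simp]: "e 0 = 0" by (simp add: e_def)
  have e_surj: "\<exists>k. e k = y" if "y \<in> D" for y
    using from_nat_into_surj[of "insert 0 D" y] D(1) that
    by (auto simp: e_def intro: exI[of _ "Suc _"])
  have [measurable]: "(\<lambda>y. norm (y - c)) \<in> borel_measurable borel" for c :: 'b
    by (intro borel_measurable_continuous_onI continuous_intros)
  define P where "P i t k \<longleftrightarrow> k \<le> i \<and> (\<forall>j\<in>{..i}. norm (f t - e k) \<le> norm (f t - e j))" for i k :: nat and t
  define k where "k i t = (LEAST k. P i t k)" for i t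
  have [measurable]: "Measurable.pred M (\<lambda>t. P i t n)" for i n
    unfolding P_def by measurable
  have k_meas[measurable]: "k i \<in> measurable M (count_space UNIV)" for i
    unfolding k_def by measurable
  have "\<exists>n. P i t n" for i t
    using ex_is_arg_min_if_finite[of "{..i}" "\<lambda>j. norm (f t - e j)"]
    by (auto simp: P_def is_arg_min_linorder)
  then have Pk: "P i t (k i t)" for i t
    unfolding k_def by (metis LeastI)
  then have k_le: "k i t \<le> i" and k_min: "j \<le> i \<Longrightarrow> norm (f t - e (k i t)) \<le> norm (f t - e j)" for i t j
    by (auto simp: P_def)
  have k_zero: "k i t = 0" if "t \<notin> A" for i t
  proof -
    have "P i t 0" using supp[OF that] by (simp add: P_def)
    then show ?thesis unfolding k_def by (simp add: Least_eq_0)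
  qed
  define s where "s i t = e (k i t)" for i t
  have simple: "simple_function M (s i)" for i
  proof -
    have "s i ` space M \<subseteq> e ` {..i}" using k_le by (auto simp: s_def)
    then have "finite (s i ` space M)" by (rule finite_subset) simp
    moreover have "s i \<in> measurable M (count_space UNIV)"
      unfolding s_def by measurable
    ultimately show ?thesis
      unfolding simple_function_def by (auto intro: measurable_sets)
  qed
  have integrable: "Bochner_Integration.simple_bochner_integrable M (s i)" for i
  proof (intro Bochner_Integration.simple_bochner_integrable.intros simple)
    have "{t \<in> space M. s i t \<noteq> 0} \<subseteq> A"
      using k_zero unfolding s_def by (metis (mono_tags, lifting) Collect_mem_eq e0 mem_Collect_eq subsetI)
    then have "emeasure M {t \<in> space M. s i t \<noteq> 0} \<le> emeasure M A"
      by (intro emeasure_mono) auto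
    then show "emeasure M {t \<in> space M. s i t \<noteq> 0} \<noteq> \<infinity>"
      using fin by (auto simp: top_unique)
  qed
  have "(\<lambda>i. \<integral>\<^sup>+t. norm (f t - s i t) \<partial>M) \<longlonglongrightarrow> (\<integral>\<^sup>+t. 0 \<partial>M)"
  proof (rule nn_integral_dominated_convergence)
    show "(\<lambda>t. ennreal (norm (f t - s i t))) \<in> borel_measurable M" for i
      using borel_measurable_norm_diff_simple_function[OF f simple] by measurable
    show "(\<lambda>t. ennreal C * indicator A t) \<in> borel_measurable M" by measurable
    show "AE t in M. ennreal (norm (f t - s i t)) \<le> ennreal C * indicator A t" for i
    proof (intro AE_I2)
      fix t
      have "norm (f t - s i t) \<le> C"
        using k_min[of 0 i t] bound[of t] by (simp add: s_def)
      then show "ennreal (norm (f t - s i t)) \<le> ennreal C * indicator A t"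
        using k_zero[of t i] supp[of t] by (auto simp: s_def ennreal_leI split: split_indicator)
    qed
    show "(\<integral>\<^sup>+t. ennreal C * indicator A t \<partial>M) < \<infinity>"
      using fin by (simp add: nn_integral_cmult_indicator ennreal_mult_less_top)
    show "AE t in M. (\<lambda>i. ennreal (norm (f t - s i t))) \<longlonglongrightarrow> 0"
    proof (rule AE_I2)
      fix t assume t: "t \<in> space M"
      have "(\<lambda>i. norm (f t - s i t)) \<longlonglongrightarrow> 0"
      proof (rule metric_LIMSEQ_I)
        fix r :: real assume "0 < r"
        then obtain y where y: "y \<in> D" "dist y (f t) < r"
          using D(2) t closure_approachable[of "f t" D] by blast
        obtain j where j: "e j = y" using e_surj[OF y(1)] ..
        have "dist (norm (f t - s i t)) 0 < r" if "j \<le> i" for i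
          using k_min[OF that, of t] j y(2) by (simp add: s_def dist_norm norm_minus_commute)
        then show "\<exists>N. \<forall>i\<ge>N. dist (norm (f t - s i t)) 0 < r" by blast
      qed
      then show "(\<lambda>i. ennreal (norm (f t - s i t))) \<longlonglongrightarrow> 0"
        using tendsto_ennrealI[of _ 0] by simp
    qed
  qed simp
  then have "(\<lambda>i. \<integral>\<^sup>+t. norm (f t - s i t) \<partial>M) \<longlonglongrightarrow> 0" by simp
  then show ?thesis
    by (rule bochner_integral_is_exists_of_simple[OF f integrable])
qed

lemma bochner_integral_is_functional:
  fixes f :: "'a \<Rightarrow> 'b::real_normed_vector" and \<phi> :: "'b \<Rightarrow>\<^sub>L real"
  assumes "bochner_integral_is M f v"
  shows "has_bochner_integral M (\<lambda>t. blinfun_apply \<phi> (f t)) (blinfun_apply \<phi> v)"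
  using assms
proof cases
  case (1 s)
  note [measurable] = \<open>f \<in> borel_measurable M\<close>
  have [measurable]: "blinfun_apply \<phi> \<in> borel_measurable borel"
    by (intro borel_measurable_continuous_onI continuous_intros)
  have s: "simple_function M (s i)" for i
    using 1(2)[of i] by (auto elim: Bochner_Integration.simple_bochner_integrable.cases)
  show ?thesis
  proof (rule has_bochner_integral.intros)
    show "(\<lambda>t. blinfun_apply \<phi> (f t)) \<in> borel_measurable M" by measurable
    show "Bochner_Integration.simple_bochner_integrable M (\<lambda>t. blinfun_apply \<phi> (s i t))" for i
      using 1(2)[of i] simple_bochner_integrable_compose2[of "\<lambda>x y. blinfun_apply \<phi> x" M "s i" "s i"]
      by (simp add: blinfun.zero_right)
    have lim: "(\<lambda>i. norm \<phi> * (\<integral>\<^sup>+t. norm (f t - s i t) \<partial>M)) \<longlonglongrightarrow> ennreal (norm \<phi>) * 0"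
      by (intro ennreal_tendsto_cmult 1) simp
    have le: "(\<integral>\<^sup>+t. norm (blinfun_apply \<phi> (f t) - blinfun_apply \<phi> (s i t)) \<partial>M)
        \<le> norm \<phi> * (\<integral>\<^sup>+t. norm (f t - s i t) \<partial>M)" for i
    proof -
      have "(\<integral>\<^sup>+t. norm (blinfun_apply \<phi> (f t) - blinfun_apply \<phi> (s i t)) \<partial>M)
        \<le> (\<integral>\<^sup>+t. ennreal (norm \<phi>) * ennreal (norm (f t - s i t)) \<partial>M)"
        using norm_blinfun[of \<phi>]
        by (intro nn_integral_mono) (simp add: blinfun.diff_right ennreal_leI flip: ennreal_mult blinfun.diff_right)
      also have "\<dots> = norm \<phi> * (\<integral>\<^sup>+t. norm (f t - s i t) \<partial>M)"
        by (intro nn_integral_cmult measurable_compose[OF _ measurable_ennreal]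
            borel_measurable_norm_diff_simple_function[OF 1(1) s])
      finally show ?thesis .
    qed
    show "(\<lambda>i. \<integral>\<^sup>+t. norm (blinfun_apply \<phi> (f t) - blinfun_apply \<phi> (s i t)) \<partial>M) \<longlonglongrightarrow> 0"
    proof (rule tendsto_sandwich[where f = "\<lambda>_. 0"])
      show "\<forall>\<^sub>F i in sequentially. (\<integral>\<^sup>+t. norm (blinfun_apply \<phi> (f t) - blinfun_apply \<phi> (s i t)) \<partial>M)
          \<le> norm \<phi> * (\<integral>\<^sup>+t. norm (f t - s i t) \<partial>M)"
        using le by (rule always_eventually[OF allI])
      show "\<forall>\<^sub>F i in sequentially. 0 \<le> (\<integral>\<^sup>+t. norm (blinfun_apply \<phi> (f t) - blinfun_apply \<phi> (s i t)) \<partial>M)"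
        by simp
      show "(\<lambda>i::nat. 0 :: ennreal) \<longlonglongrightarrow> 0" by simp
      show "(\<lambda>i. norm \<phi> * (\<integral>\<^sup>+t. norm (f t - s i t) \<partial>M)) \<longlonglongrightarrow> 0"
        using lim by simp
    qed
    have "(\<lambda>i. blinfun_apply \<phi> (Bochner_Integration.simple_bochner_integral M (s i))) \<longlonglongrightarrow> blinfun_apply \<phi> v"
      by (intro tendsto_intros 1)
    moreover have lin: "linear (blinfun_apply \<phi>)"
      by (simp add: blinfun.bounded_linear_right bounded_linear.linear)
    ultimately show "(\<lambda>i. Bochner_Integration.simple_bochner_integral M (\<lambda>t. blinfun_apply \<phi> (s i t))) \<longlonglongrightarrow> blinfun_apply \<phi> v"
      by (simp add: simple_bochner_integral_linear[OF lin 1(2)])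
  qed
qed

lemma blinfun_functional_eqI:
  fixes v w :: "'b::real_normed_vector"
  assumes "\<And>\<phi> :: 'b \<Rightarrow>\<^sub>L real. blinfun_apply \<phi> v = blinfun_apply \<phi> w"
  shows "v = w"
proof -
  obtain \<phi> :: "'b \<Rightarrow>\<^sub>L real" where "blinfun_apply \<phi> (v - w) = norm (v - w)"
    by (rule norming_functional)
  then show ?thesis
    using assms[of \<phi>] by (simp add: blinfun.diff_right)
qed

lemma bochner_integral_on_functional:
  fixes f :: "'a \<Rightarrow> 'b::banach" and \<phi> :: "'b \<Rightarrow>\<^sub>L real"
  assumes weak: "\<And>\<phi> :: 'b \<Rightarrow>\<^sub>L real. (\<lambda>t. blinfun_apply \<phi> (f t)) \<in> borel_measurable M"
    and D: "countable D" "f ` space M \<subseteq> closure D"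
    and bound: "\<And>t. norm (f t) \<le> C"
    and A: "A \<in> sets M" "emeasure M A < \<infinity>"
  shows "set_integrable M A (\<lambda>t. blinfun_apply \<phi> (f t))"
    and "blinfun_apply \<phi> (bochner_integral_on M A f) = (LINT t:A|M. blinfun_apply \<phi> (f t))"
proof -
  define h where "h t = indicator A t *\<^sub>R f t" for t
  have h: "h ` space M \<subseteq> closure (insert 0 D)" "\<And>t. norm (h t) \<le> C"
    using D(2) closure_mono[of D "insert 0 D"] closure_subset[of "insert 0 D"] bound
      norm_ge_zero[THEN order_trans, OF bound]
    by (auto simp: h_def image_subset_iff subset_iff split: split_indicator)
  have "h \<in> borel_measurable M"
    using weak A(1) h(1) D(1)
    by (intro pettis_measurability[where D = "insert 0 D"]) (auto simp: h_def blinfun.scaleR_right)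
  then have "\<exists>v. bochner_integral_is M h v"
    using h D(1) A by (intro bochner_integral_is_exists[where D = "insert 0 D" and A = A]) (auto simp: h_def)
  then obtain v where v: "bochner_integral_is M h v" ..
  have "w = v" if "bochner_integral_is M h w" for w
    by (rule blinfun_functional_eqI)
      (rule has_bochner_integral_eq[OF bochner_integral_is_functional[OF that] bochner_integral_is_functional[OF v]])
  with v have "bochner_integral_is M h (bochner_integral_on M A f)"
    unfolding bochner_integral_on_def h_def by (rule theI)
  then have "has_bochner_integral M (\<lambda>t. indicator A t *\<^sub>R blinfun_apply \<phi> (f t))
      (blinfun_apply \<phi> (bochner_integral_on M A f))"
    using bochner_integral_is_functional[of M h] by (simp add: h_def blinfun.scaleR_right)
  then show "set_integrable M A (\<lambda>t. blinfun_apply \<phi> (f t))"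
    and "blinfun_apply \<phi> (bochner_integral_on M A f) = (LINT t:A|M. blinfun_apply \<phi> (f t))"
    unfolding set_integrable_def set_lebesgue_integral_def
    by (auto simp: has_bochner_integral_iff)
qed

section \<open>Ergodic averages\<close>

lemma set_integral_le_const:
  fixes f :: "'a \<Rightarrow> real"
  assumes "set_integrable M A f" and A: "A \<in> sets M" "emeasure M A < \<infinity>"
    and "\<And>t. t \<in> A \<Longrightarrow> f t \<le> C"
  shows "(LINT t:A|M. f t) \<le> C * measure M A"
proof -
  have "(LINT t:A|M. f t) \<le> (LINT t:A|M. C)"
    using assms by (intro set_integral_mono) (auto simp: set_integrable_def)
  also have "\<dots> = C * measure M A"
    using A by (simp add: set_lebesgue_integral_def measure_def)
  finally show ?thesis .
qed

lemma functional_le_norm: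
  fixes \<phi> :: "'b::real_normed_vector \<Rightarrow>\<^sub>L real"
  assumes "norm \<phi> \<le> 1" "norm z \<le> r"
  shows "blinfun_apply \<phi> z \<le> r"
proof -
  have "\<bar>blinfun_apply \<phi> z\<bar> \<le> norm \<phi> * norm z"
    using norm_blinfun[of \<phi> z] by simp
  also have "\<dots> \<le> 1 * r"
    using assms by (intro mult_mono) auto
  finally show ?thesis by simp
qed

locale borel_strong_action =
  fixes \<mu> :: "'g::{topological_group_add, t2_space} measure"
    and \<pi> :: "'g \<Rightarrow> 'b::banach \<Rightarrow>\<^sub>L 'b"
    and F :: "nat \<Rightarrow> 'g set"
  assumes haar: "left_haar_measure \<mu>"
    and act: "acts_borel_strongly \<pi>"
    and folner: "folner_sequence \<mu> F"
begin

abbreviation avg :: "nat \<Rightarrow> 'b \<Rightarrow> 'b" where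
  "avg n x \<equiv> ergodic_average \<mu> \<pi> F n x"

lemma space_haar[simp]: "space \<mu> = UNIV"
  and sets_borel_haar: "sets borel \<subseteq> sets \<mu>"
  using haar unfolding left_haar_measure_def by (elim conjE; simp)+

lemma translate_haar:
  assumes "A \<in> sets \<mu>"
  shows "(+) g ` A \<in> sets \<mu>" and "emeasure \<mu> ((+) g ` A) = emeasure \<mu> A"
proof -
  have "\<forall>g. \<forall>A\<in>sets \<mu>. (+) g ` A \<in> sets \<mu> \<and> emeasure \<mu> ((+) g ` A) = emeasure \<mu> A"
    using haar unfolding left_haar_measure_def by (elim conjE)
  then show "(+) g ` A \<in> sets \<mu>" "emeasure \<mu> ((+) g ` A) = emeasure \<mu> A"
    using assms by blast+
qed

lemma folner_set:
  shows folner_in_sets[measurable, simp]: "F n \<in> sets \<mu>"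
    and folner_finite: "emeasure \<mu> (F n) < \<infinity>"
    and folner_finite_top[simp]: "emeasure \<mu> (F n) < top"
    and folner_pos: "0 < measure \<mu> (F n)"
proof -
  have "\<forall>n. compact (F n) \<and> 0 < measure \<mu> (F n)"
    using folner unfolding folner_sequence_def by (elim conjE)
  then have F: "compact (F n)" "0 < measure \<mu> (F n)" by blast+
  then show "F n \<in> sets \<mu>" "0 < measure \<mu> (F n)"
    using borel_compact[of "F n"] sets_borel_haar by auto
  have "\<forall>K. compact K \<longrightarrow> emeasure \<mu> K < \<infinity>"
    using haar unfolding left_haar_measure_def by (elim conjE)
  then show "emeasure \<mu> (F n) < \<infinity>"
    using F(1) by blast
  then show "emeasure \<mu> (F n) < top" by simp
qed

lemma translation_measurable[measurable]: "(+) h \<in> measurable \<mu> \<mu>"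
proof (rule measurableI)
  fix A assume "A \<in> sets \<mu>"
  moreover have "(+) h -` A \<inter> space \<mu> = (+) (- h) ` A"
    by (force simp: image_iff add.assoc[symmetric])
  ultimately show "(+) h -` A \<inter> space \<mu> \<in> sets \<mu>"
    using translate_haar(1) by simp
qed simp

lemma distr_translation: "distr \<mu> \<mu> ((+) h) = \<mu>"
proof (rule measure_eqI)
  fix A assume "A \<in> sets (distr \<mu> \<mu> ((+) h))"
  then have A: "A \<in> sets \<mu>" by simp
  moreover have "(+) h -` A \<inter> space \<mu> = (+) (- h) ` A"
    by (force simp: image_iff add.assoc[symmetric])
  ultimately show "emeasure (distr \<mu> \<mu> ((+) h)) A = emeasure \<mu> A"
    using translate_haar(2) by (simp add: emeasure_distr)
qed simp

lemma set_integral_translation: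
  fixes \<psi> :: "'g \<Rightarrow> real"
  assumes [measurable]: "\<psi> \<in> borel_measurable \<mu>" "A \<in> sets \<mu>"
  shows "(LINT g:A|\<mu>. \<psi> (h + g)) = (LINT g:(+) h ` A|\<mu>. \<psi> g)"
proof -
  note [measurable] = translate_haar(1)[OF assms(2)]
  have "(LINT g:(+) h ` A|\<mu>. \<psi> g) = (LINT g|distr \<mu> \<mu> ((+) h). indicator ((+) h ` A) g *\<^sub>R \<psi> g)"
    by (simp add: distr_translation set_lebesgue_integral_def)
  also have "\<dots> = (LINT g|\<mu>. indicator ((+) h ` A) (h + g) *\<^sub>R \<psi> (h + g))"
    by (rule integral_distr) auto
  also have "\<dots> = (LINT g:A|\<mu>. \<psi> (h + g))"
    unfolding set_lebesgue_integral_def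
    by (intro Bochner_Integration.integral_cong refl) (auto simp: indicator_def)
  finally show ?thesis by simp
qed

lemma action_add: "blinfun_apply (\<pi> g) (blinfun_apply (\<pi> h) x) = blinfun_apply (\<pi> (g + h)) x"
proof -
  have "\<forall>g h. \<pi> g o\<^sub>L \<pi> h = \<pi> (g + h)"
    using act unfolding acts_borel_strongly_def by (elim conjE)
  then show ?thesis
    by (simp flip: blinfun_apply_blinfun_compose)
qed

lemma norm_action_le: "norm (blinfun_apply (\<pi> g) x) \<le> norm x"
proof -
  have "\<forall>g. norm (\<pi> g) = 1"
    using act unfolding acts_borel_strongly_def by (elim conjE)
  then show ?thesis
    using norm_blinfun[of "\<pi> g" x] by simp
qed

lemma orbit_measurable:
  fixes \<phi> :: "'b \<Rightarrow>\<^sub>L real"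
  shows "(\<lambda>g. blinfun_apply \<phi> (blinfun_apply (\<pi> (- g)) x)) \<in> borel_measurable \<mu>"
proof -
  have "(\<lambda>g. blinfun_apply \<phi> (blinfun_apply (\<pi> g) x)) \<in> borel_measurable borel"
    using act unfolding acts_borel_strongly_def by blast
  moreover have "(uminus :: 'g \<Rightarrow> 'g) \<in> borel_measurable borel"
    by (intro borel_measurable_continuous_onI continuous_intros)
  ultimately have "(\<lambda>g. blinfun_apply \<phi> (blinfun_apply (\<pi> (- g)) x)) \<in> borel_measurable borel"
    by (rule measurable_compose[rotated])
  then show ?thesis
    using sets_borel_haar by (auto simp: measurable_def)
qed

lemma orbit_separable:
  obtains D where "countable D" "range (\<lambda>g. blinfun_apply (\<pi> (- g)) x) \<subseteq> closure D"
proof -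
  let ?R = "range (\<lambda>g. blinfun_apply (\<pi> g) x)"
  have "separable_space (top_of_set ?R)"
    using act unfolding acts_borel_strongly_def by blast
  then obtain D where D: "countable D" "D \<subseteq> ?R" "top_of_set ?R closure_of D = ?R"
    unfolding separable_space_def by auto
  then have "?R \<subseteq> closure D"
    by (metis Int_lower2 closure_of_subtopology inf.orderE euclidean_closure_of closure_of_subtopology_subset)
  then show ?thesis
    using that[OF D(1)] by auto
qed

lemma orbit_integral:
  fixes \<phi> :: "'b \<Rightarrow>\<^sub>L real"
  assumes "A \<in> sets \<mu>" "emeasure \<mu> A < \<infinity>"
  shows "set_integrable \<mu> A (\<lambda>g. blinfun_apply \<phi> (blinfun_apply (\<pi> (- g)) x))"
    and "blinfun_apply \<phi> (bochner_integral_on \<mu> A (\<lambda>g. blinfun_apply (\<pi> (- g)) x)) =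
      (LINT g:A|\<mu>. blinfun_apply \<phi> (blinfun_apply (\<pi> (- g)) x))"
proof -
  obtain D where D: "countable D" "range (\<lambda>g. blinfun_apply (\<pi> (- g)) x) \<subseteq> closure D"
    by (rule orbit_separable)
  note I = bochner_integral_on_functional[where M = \<mu> and f = "\<lambda>g. blinfun_apply (\<pi> (- g)) x",
      OF orbit_measurable D(1) _ norm_action_le assms]
  show "set_integrable \<mu> A (\<lambda>g. blinfun_apply \<phi> (blinfun_apply (\<pi> (- g)) x))"
    "blinfun_apply \<phi> (bochner_integral_on \<mu> A (\<lambda>g. blinfun_apply (\<pi> (- g)) x)) =
      (LINT g:A|\<mu>. blinfun_apply \<phi> (blinfun_apply (\<pi> (- g)) x))"
    by (rule I; use D(2) in simp)+
qed

lemma avg_functional: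
  fixes \<phi> :: "'b \<Rightarrow>\<^sub>L real"
  shows "blinfun_apply \<phi> (avg n x) =
    (LINT g:F n|\<mu>. blinfun_apply \<phi> (blinfun_apply (\<pi> (- g)) x)) / measure \<mu> (F n)"
  unfolding ergodic_average_def by (simp add: blinfun.scaleR_right orbit_integral(2))

lemma avg_add: "avg n (x + y) = avg n x + avg n y"
  by (rule blinfun_functional_eqI)
    (simp add: avg_functional blinfun.add_right set_integral_add(2) orbit_integral(1) add_divide_distrib)

lemma avg_scaleR: "avg n (c *\<^sub>R x) = c *\<^sub>R avg n x"
  by (rule blinfun_functional_eqI) (simp add: avg_functional blinfun.scaleR_right)

lemma norm_avg_le: "norm (avg n x) \<le> norm x"
proof -
  obtain \<phi> :: "'b \<Rightarrow>\<^sub>L real" where \<phi>: "norm \<phi> \<le> 1" "blinfun_apply \<phi> (avg n x) = norm (avg n x)"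
    by (rule norming_functional)
  have "(LINT g:F n|\<mu>. blinfun_apply \<phi> (blinfun_apply (\<pi> (- g)) x)) \<le> norm x * measure \<mu> (F n)"
    by (intro set_integral_le_const orbit_integral functional_le_norm \<phi> norm_action_le) auto
  then show ?thesis
    using \<phi>(2) folner_pos[of n] by (simp add: avg_functional field_simps)
qed

lemma bounded_linear_avg: "bounded_linear (avg n)"
  using norm_avg_le by (intro bounded_linear_intro[where K = 1]) (auto simp: avg_add avg_scaleR)

lemma norm_avg_diff_translate_le:
  "norm (avg m x - avg m (blinfun_apply (\<pi> (- h)) x)) \<le>
     norm x * (measure \<mu> (sym_diff (F m) ((+) h ` F m)) / measure \<mu> (F m))"
proof -
  let ?hF = "(+) h ` F m"
  let ?S = "sym_diff (F m) ?hF"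
  have hF[measurable, simp]: "?hF \<in> sets \<mu>" and hF_fin: "emeasure \<mu> ?hF < \<infinity>"
    using translate_haar[of "F m" h] folner_finite[of m] by auto
  have S: "?S \<in> sets \<mu>" "emeasure \<mu> ?S < \<infinity>"
  proof -
    show "?S \<in> sets \<mu>" by auto
    have "emeasure \<mu> ?S \<le> emeasure \<mu> (F m \<union> ?hF)"
      by (intro emeasure_mono) auto
    also have "\<dots> \<le> emeasure \<mu> (F m) + emeasure \<mu> ?hF"
      by (intro emeasure_subadditive) auto
    also have "\<dots> < \<infinity>" using hF_fin folner_finite[of m] by simp
    finally show "emeasure \<mu> ?S < \<infinity>" .
  qed
  obtain \<phi> :: "'b \<Rightarrow>\<^sub>L real" where \<phi>: "norm \<phi> \<le> 1"
    "blinfun_apply \<phi> (avg m x - avg m (blinfun_apply (\<pi> (- h)) x)) =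
      norm (avg m x - avg m (blinfun_apply (\<pi> (- h)) x))"
    by (rule norming_functional)
  define \<psi> where "\<psi> g = blinfun_apply \<phi> (blinfun_apply (\<pi> (- g)) x)" for g
  have \<psi>[measurable]: "\<psi> \<in> borel_measurable \<mu>"
    unfolding \<psi>_def by (rule orbit_measurable)
  have \<psi>_le: "\<bar>\<psi> g\<bar> \<le> norm x" for g
    using functional_le_norm[OF \<phi>(1) norm_action_le[of "- g" x]]
      functional_le_norm[OF \<phi>(1), of "- blinfun_apply (\<pi> (- g)) x" "norm x"] norm_action_le[of "- g" x]
    by (simp add: \<psi>_def blinfun.minus_right abs_le_iff)
  have int: "set_integrable \<mu> (F m) \<psi>" "set_integrable \<mu> ?hF \<psi>"
    unfolding \<psi>_def using hF_fin by (auto intro: orbit_integral)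
  have "blinfun_apply \<phi> (avg m (blinfun_apply (\<pi> (- h)) x)) = (LINT g:F m|\<mu>. \<psi> (h + g)) / measure \<mu> (F m)"
    by (simp add: avg_functional action_add \<psi>_def minus_add)
  then have "norm (avg m x - avg m (blinfun_apply (\<pi> (- h)) x)) =
      ((LINT g:F m|\<mu>. \<psi> g) - (LINT g:?hF|\<mu>. \<psi> g)) / measure \<mu> (F m)"
    unfolding \<phi>(2)[symmetric] blinfun.diff_right
    by (simp add: avg_functional[of \<phi> m x] set_integral_translation \<psi>_def[symmetric] diff_divide_distrib)
  also have "(LINT g:F m|\<mu>. \<psi> g) - (LINT g:?hF|\<mu>. \<psi> g) =
      (LINT g|\<mu>. indicator (F m) g *\<^sub>R \<psi> g - indicator ?hF g *\<^sub>R \<psi> g)"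
    using int unfolding set_lebesgue_integral_def set_integrable_def
    by (rule Bochner_Integration.integral_diff[symmetric])
  also have "\<dots> \<le> (LINT g|\<mu>. norm x * indicator ?S g)"
  proof (rule integral_mono)
    show "integrable \<mu> (\<lambda>g. indicator (F m) g *\<^sub>R \<psi> g - indicator ?hF g *\<^sub>R \<psi> g)"
      using int unfolding set_integrable_def by (rule Bochner_Integration.integrable_diff)
    show "integrable \<mu> (\<lambda>g. norm x * indicator ?S g)"
      using S by (intro integrable_mult_right integrable_real_indicator)
    show "indicator (F m) g *\<^sub>R \<psi> g - indicator ?hF g *\<^sub>R \<psi> g \<le> norm x * indicator ?S g" for g
      using \<psi>_le[of g] by (auto simp: indicator_def)
  qed
  also have "\<dots> = norm x * measure \<mu> ?S"
    using S by simp
  finally show ?thesis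
    using folner_pos[of m] by (simp add: divide_right_mono)
qed

text \<open>
  \<open>avg m\<close> commutes with the Bochner integral defining \<open>avg n x\<close>, so no Fubini theorem is needed:
  the integrand at \<open>h\<close> is small if \<open>h\<close> moves \<open>F m\<close> little, and at most \<open>2 * norm x\<close> otherwise.
\<close>

lemma norm_avg_diff_avg_avg_le:
  assumes F': "F' \<in> sets \<mu>" "F' \<subseteq> F n"
    and F'_large: "measure \<mu> (F n - F') \<le> measure \<mu> (F n) * \<delta>"
    and F'_inv: "\<And>h. h \<in> F' \<Longrightarrow>
      measure \<mu> (sym_diff (F m) ((+) h ` F m)) \<le> measure \<mu> (F m) * \<delta>"
    and "0 \<le> \<delta>"
  shows "norm (avg m x - avg m (avg n x)) \<le> 3 * \<delta> * norm x"
proof -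
  obtain \<phi> :: "'b \<Rightarrow>\<^sub>L real" where \<phi>: "norm \<phi> \<le> 1"
    "blinfun_apply \<phi> (avg m x - avg m (avg n x)) = norm (avg m x - avg m (avg n x))"
    by (rule norming_functional)
  define \<psi> where "\<psi> = \<phi> o\<^sub>L Blinfun (avg m)"
  have \<psi>: "blinfun_apply \<psi> z = blinfun_apply \<phi> (avg m z)" for z
    by (simp add: \<psi>_def bounded_linear_Blinfun_apply[OF bounded_linear_avg])
  define d where "d h = blinfun_apply \<phi> (avg m x) - blinfun_apply \<psi> (blinfun_apply (\<pi> (- h)) x)" for h
  have d: "d h = blinfun_apply \<phi> (avg m x - avg m (blinfun_apply (\<pi> (- h)) x))" for h
    by (simp add: d_def \<psi> blinfun.diff_right)
  have d1: "d h \<le> 2 * norm x" for h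
  proof -
    have "norm (avg m x - avg m (blinfun_apply (\<pi> (- h)) x)) \<le> norm x + norm x"
      by (meson norm_triangle_le_diff add_mono norm_avg_le norm_action_le order_trans)
    then show ?thesis unfolding d by (intro functional_le_norm \<phi>) simp
  qed
  have d2: "d h \<le> \<delta> * norm x" if "h \<in> F'" for h
  proof -
    have "measure \<mu> (sym_diff (F m) ((+) h ` F m)) / measure \<mu> (F m) \<le> \<delta>"
      using F'_inv[OF that] folner_pos[of m] by (simp add: field_simps)
    then have "norm x * (measure \<mu> (sym_diff (F m) ((+) h ` F m)) / measure \<mu> (F m)) \<le> \<delta> * norm x"
      by (metis mult.commute mult_left_mono norm_ge_zero)
    then show ?thesis unfolding d
      by (intro functional_le_norm \<phi> order_trans[OF norm_avg_diff_translate_le])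
  qed
  have "emeasure \<mu> F' \<le> emeasure \<mu> (F n)"
    using F' by (intro emeasure_mono) auto
  then have F'_fin: "emeasure \<mu> F' < \<infinity>"
    using folner_finite le_less_trans by blast
  have R: "F n - F' \<in> sets \<mu>" "emeasure \<mu> (F n - F') < \<infinity>"
    using F' emeasure_mono[of "F n - F'" "F n" \<mu>] folner_finite[of n]
    by (auto intro: le_less_trans)
  have int: "set_integrable \<mu> A d" if "A \<in> sets \<mu>" "emeasure \<mu> A < \<infinity>" for A
    unfolding d_def using that orbit_integral(1)
    by (intro set_integral_diff) (auto simp: set_integrable_def)
  have "blinfun_apply \<phi> (avg m (avg n x)) =
      (LINT h:F n|\<mu>. blinfun_apply \<psi> (blinfun_apply (\<pi> (- h)) x)) / measure \<mu> (F n)"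
    unfolding \<psi>[symmetric] by (rule avg_functional)
  moreover have "(LINT h:F n|\<mu>. d h) = (LINT h:F n|\<mu>. blinfun_apply \<phi> (avg m x)) -
      (LINT h:F n|\<mu>. blinfun_apply \<psi> (blinfun_apply (\<pi> (- h)) x))"
    unfolding d_def using orbit_integral(1)
    by (intro set_integral_diff) (auto simp: set_integrable_def)
  moreover have "(LINT h:F n|\<mu>. blinfun_apply \<phi> (avg m x)) = blinfun_apply \<phi> (avg m x) * measure \<mu> (F n)"
    by (simp add: set_lebesgue_integral_def)
  ultimately have "norm (avg m x - avg m (avg n x)) * measure \<mu> (F n) = (LINT h:F n|\<mu>. d h)"
    unfolding \<phi>(2)[symmetric] using folner_pos[of n] by (simp add: blinfun.diff_right field_simps)
  also have "\<dots> = (LINT h:F'|\<mu>. d h) + (LINT h:F n - F'|\<mu>. d h)"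
    using set_integral_Un[of F' "F n - F'" \<mu> d] int F' F'_fin R by (simp add: Un_absorb1)
  also have "\<dots> \<le> \<delta> * norm x * measure \<mu> F' + 2 * norm x * measure \<mu> (F n - F')"
    using F' F'_fin R int d1 d2 by (intro add_mono set_integral_le_const) auto
  also have "\<dots> \<le> \<delta> * norm x * measure \<mu> (F n) + 2 * norm x * (measure \<mu> (F n) * \<delta>)"
    using F' F'_large \<open>0 \<le> \<delta>\<close> folner_finite
    by (intro add_mono mult_left_mono measure_mono_fmeasurable) (auto simp: fmeasurable_def top.not_eq_extremum)
  also have "\<dots> = 3 * \<delta> * norm x * measure \<mu> (F n)"
    by (simp add: algebra_simps)
  finally show ?thesis
    using folner_pos[of n] by simp
qed

end

section \<open>Fluctuations\<close>

lemma modulus_of_uniform_convexity_midpoint: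
  fixes y z :: "'b::real_normed_vector"
  assumes u: "modulus_of_uniform_convexity TYPE('b) u"
    and "0 < \<epsilon>" "0 < s" "norm y \<le> s" "norm z \<le> s" "\<epsilon> \<le> norm (y - z)"
  shows "norm ((1/2) *\<^sub>R (y + z)) \<le> max (norm y) (norm z) - s * u (\<epsilon> / s)"
proof -
  have main: "norm ((1/2) *\<^sub>R (y + z)) \<le> norm z - s * u (\<epsilon> / s)"
    if "norm y \<le> norm z" "norm z \<le> s" "\<epsilon> \<le> norm (y - z)" for y z :: 'b
  proof -
    let ?y = "(1 / s) *\<^sub>R y" and ?z = "(1 / s) *\<^sub>R z"
    have *: "\<forall>\<epsilon>>0. \<forall>x y :: 'b. norm x \<le> norm y \<and> norm y \<le> 1 \<and> \<epsilon> \<le> norm (x - y) \<longrightarrow>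
        norm ((1/2) *\<^sub>R (x + y)) \<le> norm y - u \<epsilon>"
      using u unfolding modulus_of_uniform_convexity_def by (elim conjE)
    have "norm (?y - ?z) = norm (y - z) / s"
      using \<open>0 < s\<close> by (simp flip: scaleR_diff_right)
    then have "norm ?y \<le> norm ?z \<and> norm ?z \<le> 1 \<and> \<epsilon> / s \<le> norm (?y - ?z)"
      using that \<open>0 < s\<close> by (simp add: divide_right_mono)
    moreover have "0 < \<epsilon> / s"
      using \<open>0 < s\<close> \<open>0 < \<epsilon>\<close> by simp
    ultimately have "norm ((1/2) *\<^sub>R (?y + ?z)) \<le> norm ?z - u (\<epsilon> / s)"
      using * by blast
    moreover have "norm ((1/2) *\<^sub>R (?y + ?z)) = norm ((1/2) *\<^sub>R (y + z)) / s"
      using \<open>0 < s\<close> by (simp flip: scaleR_add_right)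
    ultimately show ?thesis
      using \<open>0 < s\<close> by (simp add: field_simps)
  qed
  show ?thesis
  proof (cases "norm y \<le> norm z")
    case True
    then show ?thesis using main[of y z] assms by (simp add: max_def)
  next
    case False
    then show ?thesis using main[of z y] assms by (simp add: max_def add.commute norm_minus_commute)
  qed
qed

text \<open>
  The potential \<open>V\<close> need not decrease along a single fluctuation: only after the next time at
  distance \<open>\<beta>\<close> has it dropped, by \<open>2 * c\<close>. Hence the list is consumed two steps at a time.
\<close>

lemma fluctuation_potential:
  fixes V :: "nat \<Rightarrow> real" and X :: "nat \<Rightarrow> 'a::metric_space"
  assumes "mono \<beta>" and "0 < c"
    and low: "\<And>n. L \<le> V n"
    and drop: "\<And>n m k. n < m \<Longrightarrow> \<beta> n \<le> m \<Longrightarrow> \<epsilon> \<le> dist (X n) (X m) \<Longrightarrow> \<beta> n \<le> k \<Longrightarrow> \<beta> m \<le> k \<Longrightarrow>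
      V k \<le> V n - 2 * c"
    and "ns \<noteq> []"
    and "successively (\<lambda>n m. n < m \<and> \<beta> n \<le> m \<and> \<epsilon> \<le> dist (X n) (X m)) ns"
  shows "L + (real (length ns) - 1) * c \<le> V (hd ns)"
  using assms(5,6)
proof (induction ns rule: length_induct)
  case (1 ns)
  note IH = \<open>\<forall>ys. length ys < length ns \<longrightarrow> _\<close>
  note ns = \<open>successively _ ns\<close>
  consider a where "ns = [a]" | a b where "ns = [a, b]" | a b d ns' where "ns = a # b # d # ns'"
    using \<open>ns \<noteq> []\<close> by (metis neq_Nil_conv)
  then show ?case
  proof cases
    case (1 a)
    then show ?thesis using low by simp
  next
    case (2 a b)
    then have "V (max (\<beta> a) (\<beta> b)) \<le> V a - 2 * c"
      using ns by (intro drop[of a b]) auto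
    then show ?thesis
      using low[of "max (\<beta> a) (\<beta> b)"] 2 \<open>0 < c\<close> by simp
  next
    case (3 a b d ns')
    with ns have steps: "a < b" "\<beta> a \<le> b" "\<epsilon> \<le> dist (X a) (X b)" "\<beta> b \<le> d"
      and tail: "successively (\<lambda>n m. n < m \<and> \<beta> n \<le> m \<and> \<epsilon> \<le> dist (X n) (X m)) (d # ns')"
      by auto
    have "\<beta> a \<le> \<beta> b"
      using \<open>mono \<beta>\<close> steps(1) by (simp add: monoD)
    then have "V d \<le> V a - 2 * c"
      using steps by (intro drop[of a b]) auto
    moreover have "L + (real (length (d # ns')) - 1) * c \<le> V d"
      using IH[rule_format, of "d # ns'"] 3 tail by simp
    ultimately show ?thesis
      using 3 by (simp add: algebra_simps)
  qed
qed

lemma at_most_fluctuations_potential: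
  fixes V :: "nat \<Rightarrow> real" and X :: "nat \<Rightarrow> 'a::metric_space"
  assumes "mono \<beta>" and "0 < c" and "\<And>n. L \<le> V n"
    and "\<And>n m k. n < m \<Longrightarrow> \<beta> n \<le> m \<Longrightarrow> \<epsilon> \<le> dist (X n) (X m) \<Longrightarrow> \<beta> n \<le> k \<Longrightarrow> \<beta> m \<le> k \<Longrightarrow>
      V k \<le> V n - 2 * c"
    and up: "\<And>n. V n \<le> R"
  shows "at_most_fluctuations \<lfloor>(R - L) / c\<rfloor> \<epsilon> \<beta> X"
  unfolding at_most_fluctuations_def
proof (intro allI impI, elim conjE)
  fix ns :: "nat list"
  assume ns: "ns \<noteq> []" "sorted_wrt (<) ns"
    "\<forall>i. Suc i < length ns \<longrightarrow> \<beta> (ns ! i) \<le> ns ! Suc i \<and> \<epsilon> \<le> dist (X (ns ! i)) (X (ns ! Suc i))"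
  then have steps: "successively (\<lambda>n m. n < m \<and> \<beta> n \<le> m \<and> \<epsilon> \<le> dist (X n) (X m)) ns"
    unfolding successively_conv_nth by (auto intro: sorted_wrt_nth_less)
  have "L + (real (length ns) - 1) * c \<le> V (hd ns)"
    by (rule fluctuation_potential[OF assms(1-3) _ ns(1) steps]) (rule assms(4))
  then have "(real (length ns) - 1) * c \<le> R - L"
    using up[of "hd ns"] by simp
  then have "real (length ns) - 1 \<le> (R - L) / c"
    using \<open>0 < c\<close> by (simp add: pos_le_divide_eq)
  then show "int (length ns) - 1 \<le> \<lfloor>(R - L) / c\<rfloor>"
    by (simp add: le_floor_iff)
qed

context borel_strong_action
begin

lemma norm_avg_diff_avg_avg_le_modulus:
  assumes "folner_convergence_modulus \<mu> F \<beta>" and "0 < \<delta>" and "\<beta> n \<delta> \<le> m"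
  shows "norm (avg m x - avg m (avg n x)) \<le> 3 * \<delta> * norm x"
proof -
  obtain F' where F': "F' \<in> sets \<mu>" "F' \<subseteq> F n" "measure \<mu> (F n - F') < measure \<mu> (F n) * \<delta>"
    "\<And>g. g \<in> F' \<Longrightarrow> measure \<mu> (sym_diff (F m) ((+) g ` F m)) < measure \<mu> (F m) * \<delta>"
    using assms(1)[unfolded folner_convergence_modulus_def, rule_format, OF assms(2,3)] by auto
  then show ?thesis
    using \<open>0 < \<delta>\<close> by (intro norm_avg_diff_avg_avg_le) (auto intro: less_imp_le)
qed

lemma at_most_fluctuations_avg:
  assumes u: "modulus_of_uniform_convexity TYPE('b) u"
    and \<beta>: "folner_convergence_modulus \<mu> F \<beta>" "\<And>\<delta>. 0 < \<delta> \<Longrightarrow> mono (\<lambda>n. \<beta> n \<delta>)"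
    and "0 < \<epsilon>" "x \<noteq> 0" "0 < \<eta>" "norm x \<le> s"
    and \<eta>: "\<eta> < 1/2 * u (\<epsilon> / s)"
    and L: "\<And>n. L \<le> norm (avg n x)"
  shows "at_most_fluctuations \<lfloor>(norm x - L) / (s * (1/2 * u (\<epsilon> / s) - \<eta>))\<rfloor> \<epsilon>
    (\<lambda>n. \<beta> n (s * \<eta> / (3 * norm x))) (\<lambda>n. avg n x)"
proof (rule at_most_fluctuations_potential[where V = "\<lambda>n. norm (avg n x)"])
  let ?\<delta> = "s * \<eta> / (3 * norm x)"
  have "0 < s"
    using \<open>x \<noteq> 0\<close> \<open>norm x \<le> s\<close> by (meson less_le_trans zero_less_norm_iff)
  then have "0 < ?\<delta>"
    using \<open>x \<noteq> 0\<close> \<open>0 < \<eta>\<close> by simp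
  then show "mono (\<lambda>n. \<beta> n ?\<delta>)" by (rule \<beta>(2))
  show "0 < s * (1/2 * u (\<epsilon> / s) - \<eta>)"
    using \<open>0 < s\<close> \<eta> by simp
  show "norm (avg n x) \<le> norm x" for n by (rule norm_avg_le)
  fix n m k
  assume nm: "\<beta> n ?\<delta> \<le> m" "\<epsilon> \<le> dist (avg n x) (avg m x)" and k: "\<beta> n ?\<delta> \<le> k" "\<beta> m ?\<delta> \<le> k"
  have close: "norm (avg j x - avg j (avg i x)) \<le> s * \<eta>" if "\<beta> i ?\<delta> \<le> j" for i j
    using norm_avg_diff_avg_avg_le_modulus[OF \<beta>(1) \<open>0 < ?\<delta>\<close> that, of x] \<open>x \<noteq> 0\<close> by simp
  have "norm (avg m x) \<le> norm (avg m (avg n x)) + s * \<eta>"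
    using close[OF nm(1)] norm_triangle_sub[of "avg m x" "avg m (avg n x)"] by simp
  then have max: "max (norm (avg n x)) (norm (avg m x)) \<le> norm (avg n x) + s * \<eta>"
    using norm_avg_le[of m "avg n x"] \<open>0 < s\<close> \<open>0 < \<eta>\<close> by simp
  define z where "z = (1/2) *\<^sub>R (avg n x + avg m x)"
  have "avg k x - avg k z = (1/2) *\<^sub>R ((avg k x - avg k (avg n x)) + (avg k x - avg k (avg m x)))"
    by (simp add: z_def avg_add avg_scaleR algebra_simps flip: scaleR_add_left)
  also have "norm \<dots> \<le> s * \<eta>"
    using norm_triangle_ineq[of "avg k x - avg k (avg n x)" "avg k x - avg k (avg m x)"]
      close[OF k(1)] close[OF k(2)] by simp
  finally have "norm (avg k x) \<le> norm z + s * \<eta>"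
    using norm_triangle_sub[of "avg k x" "avg k z"] norm_avg_le[of k z] by simp
  also have "norm z \<le> max (norm (avg n x)) (norm (avg m x)) - s * u (\<epsilon> / s)"
    unfolding z_def using nm(2) norm_avg_le \<open>norm x \<le> s\<close>
    by (intro modulus_of_uniform_convexity_midpoint[OF u \<open>0 < \<epsilon>\<close> \<open>0 < s\<close>])
      (auto simp: dist_norm intro: order_trans)
  also note max
  finally show "norm (avg k x) \<le> norm (avg n x) - 2 * (s * (1/2 * u (\<epsilon> / s) - \<eta>))"
    by (simp add: algebra_simps)
qed (rule L)

end

theorem theorem21:
  fixes \<mu> :: "'g::{topological_group_add, t2_space, second_countable_topology} measure"
    and \<pi> :: "'g \<Rightarrow> 'b::banach \<Rightarrow>\<^sub>L 'b"
    and F :: "nat \<Rightarrow> 'g set"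
    and \<beta> :: "nat \<Rightarrow> real \<Rightarrow> nat"
    and u :: "real \<Rightarrow> real"
    and \<epsilon> \<eta> :: real
    and x :: 'b
  assumes "modulus_of_uniform_convexity TYPE('b) u"
    and "0 < \<epsilon>" and "x \<noteq> 0"
    and "0 < \<eta>"
    and "norm x \<le> 1 \<Longrightarrow> \<eta> < 1/2 * u \<epsilon>"
    and "1 < norm x \<Longrightarrow> \<eta> < 1/2 * u (\<epsilon> / norm x)"
    and "locally compact (UNIV :: 'g set)"
    and "left_haar_measure \<mu>"
    and "amenable \<mu>"
    and "acts_borel_strongly \<pi>"
    and "folner_sequence \<mu> F"
    and "folner_convergence_modulus \<mu> F \<beta>"
    and "\<And>\<delta>. 0 < \<delta> \<Longrightarrow> mono (\<lambda>n. \<beta> n \<delta>)"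
  shows "(norm x \<le> 1 \<longrightarrow>
           at_most_fluctuations \<lfloor>norm x / (1/2 * u \<epsilon> - \<eta>)\<rfloor> \<epsilon>
             (\<lambda>n. \<beta> n (\<eta> / (3 * norm x))) (\<lambda>n. ergodic_average \<mu> \<pi> F n x)) \<and>
         (1 < norm x \<longrightarrow>
           at_most_fluctuations \<lfloor>1 / (1/2 * u (\<epsilon> / norm x) - \<eta>)\<rfloor> \<epsilon>
             (\<lambda>n. \<beta> n (\<eta> / 3)) (\<lambda>n. ergodic_average \<mu> \<pi> F n x)) \<and>
         (\<forall>L. L \<le> (INF n. norm (ergodic_average \<mu> \<pi> F n x)) \<longrightarrow>
           (norm x \<le> 1 \<longrightarrow>
             at_most_fluctuations \<lfloor>(norm x - L) / (1/2 * u \<epsilon> - \<eta>)\<rfloor> \<epsilon>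
               (\<lambda>n. \<beta> n (\<eta> / (3 * norm x))) (\<lambda>n. ergodic_average \<mu> \<pi> F n x)) \<and>
           (1 < norm x \<longrightarrow>
             at_most_fluctuations \<lfloor>(1 - L / norm x) / (1/2 * u (\<epsilon> / norm x) - \<eta>)\<rfloor> \<epsilon>
               (\<lambda>n. \<beta> n (\<eta> / 3)) (\<lambda>n. ergodic_average \<mu> \<pi> F n x)))"
proof -
  interpret borel_strong_action \<mu> \<pi> F
    using assms(8,10,11) by (rule borel_strong_action.intro)
  note bound = at_most_fluctuations_avg[OF assms(1,12,13,2,3,4)]
  have small: "at_most_fluctuations \<lfloor>(norm x - L) / (1/2 * u \<epsilon> - \<eta>)\<rfloor> \<epsilon>
      (\<lambda>n. \<beta> n (\<eta> / (3 * norm x))) (\<lambda>n. avg n x)"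
    if "norm x \<le> 1" "\<And>n. L \<le> norm (avg n x)" for L
    using bound[of 1 L] that assms(5) by simp
  have large: "at_most_fluctuations \<lfloor>(1 - L / norm x) / (1/2 * u (\<epsilon> / norm x) - \<eta>)\<rfloor> \<epsilon>
      (\<lambda>n. \<beta> n (\<eta> / 3)) (\<lambda>n. avg n x)"
    if "1 < norm x" "\<And>n. L \<le> norm (avg n x)" for L
  proof -
    have "(norm x - L) / (norm x * c) = (1 - L / norm x) / c" for c
      using \<open>x \<noteq> 0\<close> by (simp add: field_simps)
    moreover have "norm x * \<eta> / (3 * norm x) = \<eta> / 3"
      using \<open>x \<noteq> 0\<close> by simp
    ultimately show ?thesis
      using bound[of "norm x" L] that assms(6) \<open>x \<noteq> 0\<close> by simp
  qed
  have inf: "L \<le> norm (avg n x)" if "L \<le> (INF n. norm (avg n x))" for L n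
  proof -
    have "bdd_below (range (\<lambda>n. norm (avg n x)))"
      by (rule bdd_belowI2[where m = 0]) simp
    then have "(INF n. norm (avg n x)) \<le> norm (avg n x)"
      by (rule cINF_lower) simp
    with that show ?thesis by (rule order_trans)
  qed
  show ?thesis
    using small[of 0] large[of 0] small large inf by (intro conjI allI impI) simp_all
qed

end
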